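(* Suppose that, for every state-action pair $(s,a)\in S\times A$, the (non-negative) stepsizes satisfy $$\sum_{t=0}^\infty\gamma_t(s,a)=\infty\quad\text{and}\quad\sum_{t=0}^\infty\gamma_t^2(s,a)<\infty$$ (with probability $1$). Then the sequence $Q_t$ generated by the Q-learning algorithm $$Q_{t+1}(s,a)=(1-\gamma_t(s,a))Q_t(s,a)+\gamma_t(s,a)\Big(R(s,a,s')+\beta\max_{\tilde a\in A}Q_t(s',\tilde a)\Big),$$ where $s'$ is sampled according to $p(s,a,\cdot)$, converges with probability $1$ to $Q^*$.
   Context: $S$ is a finite state space and $A$ a finite action set, all actions being feasible at every state; $p(s,a,s')$ are transition probabilities, $R:S\times A\times S\to\mathbb{R}$ is the payoff function and $\beta\in(0,1)$ the discount factor. $Q^*:S\times A\to\mathbb{R}$ is the unique fixed point of the operator $H$ on real functions on $S\times A$ given by $$HQ(s,a)=\sum_{s'\in S}p(s,a,s')\Big(R(s,a,s')+\beta\max_{a'\in A}Q(s',a')\Big)$$ (which is a $\beta$-contraction in the maximum norm). Asynchronous Q-learning: $Q_0$ is a given initial function on $S\times A$. Let $(\mathcal{F}_t)_{t\ge0}$ be the filtration of the history up to time $t$. At time $t$ a pair $(s_t,a_t)$, measurable with respect to $\mathcal{F}_t$, is observed; the stepsizes $\gamma_t(s,a)\ge0$ are $\mathcal{F}_t$-measurable with $\gamma_t(s,a)=0$ for $(s,a)\ne(s_t,a_t)$, so only the value at $(s_t,a_t)$ is updated; the sample $s'$ used in that update has conditional law $p(s_t,a_t,\cdot)$ given $\mathcal{F}_t$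 and is $\mathcal{F}_{t+1}$-measurable. *)

theory Defs
  imports "HOL-Probability.Probability"
begin

definition bellman ::
  "('s::finite \<Rightarrow> 'a::finite \<Rightarrow> 's pmf) \<Rightarrow> ('s \<Rightarrow> 'a \<Rightarrow> 's \<Rightarrow> real) \<Rightarrow> real
    \<Rightarrow> ('s \<Rightarrow> 'a \<Rightarrow> real) \<Rightarrow> ('s \<Rightarrow> 'a \<Rightarrow> real)" where
  "bellman p R \<beta> Q =
    (\<lambda>s a. \<Sum>s'\<in>UNIV. pmf (p s a) s' * (R s a s' + \<beta> * (MAX a'\<in>UNIV. Q s' a')))"

(* Meaningful for 0 < beta < 1, when the operator is a contraction in the maximum norm. *)
definition Q_star ::
  "('s::finite \<Rightarrow> 'a::finite \<Rightarrow> 's pmf) \<Rightarrow> ('s \<Rightarrow> 'a \<Rightarrow> 's \<Rightarrow> real) \<Rightarrow> real \<Rightarrow> ('s \<Rightarrow> 'a \<Rightarrow> real)" where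
  "Q_star p R \<beta> = (THE Q. bellman p R \<beta> Q = Q)"

(* The conditional law of the random state X given the sub-sigma-algebra F is the random
   distribution mu; on a finite type it suffices to prescribe it on singletons. *)
definition has_cond_law ::
  "'w measure \<Rightarrow> 'w measure \<Rightarrow> ('w \<Rightarrow> 's::finite) \<Rightarrow> ('w \<Rightarrow> 's pmf) \<Rightarrow> bool" where
  "has_cond_law M F X \<mu> \<longleftrightarrow>
    (\<forall>x. AE \<omega> in M. real_cond_exp M F (indicat_real {\<omega>. X \<omega> = x}) \<omega> = pmf (\<mu> \<omega>) x)"

end

(* Q-learning is an asynchronous fixed-point iteration for the contraction bellman, perturbed by
   martingale-difference noise. The weighted noise gamma_t * w_t is square summable after a
   predictable truncation, so its series converges almost surely by Kolmogorov's maximal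
   inequality. On each such path the noise can be absorbed into the error up to a vanishing
   term; a bound D on all error components then eventually improves to beta * D plus an
   arbitrarily small amount, because the steps at each pair sum to infinity. *)
theory Submission
  imports Defs
begin

section \<open>Square-integrable martingale differences\<close>

text \<open>The steps are square summable only path by path and may exceed 1 at early times, so
  neither they nor the iterates have a deterministic bound, and the weighted noise need not be
  square integrable. This forces the truncation; its level depends on the path, but countably many
  levels suffice. There is no circularity: rewards on finite sets are bounded, so each path of
  iterates is bounded whatever samples are drawn, before anything is known about the noise.
  Asynchrony enters the noise only through its weight, which vanishes whenever another pair is
  visited. It also gives each pair its own clock, so the contraction is used through a common bound
  on all errors that each component improves in its own time.\<close>

lemma (in filtration) borel_measurable_mono:
  assumes "i \<le> j" and "f \<in> borel_measurable (F i)"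
  shows "f \<in> borel_measurable (F j)"
  using assms sets_F_mono[of i j] space_F
  by (auto intro: measurable_mono[THEN subsetD, rotated -1])

lemma integrable_mult_of_square_integrable:
  fixes f g :: "'a \<Rightarrow> real"
  assumes [measurable]: "f \<in> borel_measurable M" "g \<in> borel_measurable M"
    and "integrable M (\<lambda>x. (f x)\<^sup>2)" "integrable M (\<lambda>x. (g x)\<^sup>2)"
  shows "integrable M (\<lambda>x. f x * g x)"
proof (rule Bochner_Integration.integrable_bound)
  show "integrable M (\<lambda>x. (f x)\<^sup>2 + (g x)\<^sup>2)"
    using assms by simp
  have "\<bar>a * b\<bar> \<le> a\<^sup>2 + b\<^sup>2" for a b :: real
  proof -
    have "2 * (\<bar>a\<bar> * \<bar>b\<bar>) \<le> a\<^sup>2 + b\<^sup>2"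
      using sum_squares_bound[of "\<bar>a\<bar>" "\<bar>b\<bar>"] by simp
    moreover have "0 \<le> \<bar>a\<bar> * \<bar>b\<bar>" by simp
    ultimately show ?thesis unfolding abs_mult by linarith
  qed
  then show "AE x in M. norm (f x * g x) \<le> norm ((f x)\<^sup>2 + (g x)\<^sup>2)"
    by (intro AE_I2) (smt (verit) real_norm_def)
qed measurable

text \<open>The increment \<open>d t\<close> is revealed between \<open>t\<close> and
  \<open>Suc t\<close>. This shift by one makes a multiplier that is measurable for
  \<open>F t\<close> known before the increment it multiplies.\<close>

locale L2_martingale_differences = prob_space M + filtration "space M" F
  for M :: "'w measure" and F :: "nat \<Rightarrow> 'w measure" +
  fixes d :: "nat \<Rightarrow> 'w \<Rightarrow> real"
  assumes subalg: "subalgebra M (F t)"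
    and adapted: "d t \<in> borel_measurable (F (Suc t))"
    and square_integrable: "integrable M (\<lambda>\<omega>. (d t \<omega>)\<^sup>2)"
    and cond_exp_zero: "AE \<omega> in M. real_cond_exp M (F t) (d t) \<omega> = 0"
begin

lemma borel_measurable_d [measurable]: "d t \<in> borel_measurable M"
  using measurable_from_subalg[OF subalg adapted] .

lemma borel_measurable_d': "j < t \<Longrightarrow> d j \<in> borel_measurable (F t)"
  by (rule borel_measurable_mono[OF Suc_leI adapted])

text \<open>A factor known at time \<open>t\<close> can be kept while \<open>d t\<close> is replaced
  by its conditional expectation, which vanishes.\<close>

lemma orthogonal:
  assumes f: "f \<in> borel_measurable (F t)" and "integrable M (\<lambda>\<omega>. (f \<omega>)\<^sup>2)"
  shows "(\<integral>\<omega>. f \<omega> * d t \<omega> \<partial>M) = 0"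
proof -
  interpret finite_measure_subalgebra M "F t"
    using subalg by unfold_locales
  have [measurable]: "f \<in> borel_measurable M"
    using measurable_from_subalg[OF subalg f] .
  have "integrable M (\<lambda>\<omega>. f \<omega> * d t \<omega>)"
    using assms square_integrable by (intro integrable_mult_of_square_integrable) measurable
  then have "(\<integral>\<omega>. f \<omega> * d t \<omega> \<partial>M) = (\<integral>\<omega>. f \<omega> * real_cond_exp M (F t) (d t) \<omega> \<partial>M)"
    using f by (intro real_cond_exp_intg(2)[symmetric]) auto
  also have "\<dots> = (\<integral>\<omega>. 0 \<partial>M)"
    using cond_exp_zero[of t] by (intro integral_cong_AE) (auto simp: borel_measurable_cond_exp2)
  finally show ?thesis by simp
qed

text \<open>This is a martingale transform: the multipliers are predictable, so all cross terms have
  mean zero, and being at most 1 in modulus they do not increase the variances. The maximal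
  inequality uses it with the indicator of not having stopped yet.\<close>

lemma square_expectation_transform:
  assumes h: "\<And>j. h j \<in> borel_measurable (F j)" and h1: "\<And>j \<omega>. \<bar>h j \<omega>\<bar> \<le> 1" and "m \<le> n"
  shows "integrable M (\<lambda>\<omega>. (\<Sum>j=m..<n. h j \<omega> * d j \<omega>)\<^sup>2)"
    and "(\<integral>\<omega>. (\<Sum>j=m..<n. h j \<omega> * d j \<omega>)\<^sup>2 \<partial>M) \<le> (\<Sum>j=m..<n. \<integral>\<omega>. (d j \<omega>)\<^sup>2 \<partial>M)"
proof -
  have hM [measurable]: "h j \<in> borel_measurable M" for j
    using measurable_from_subalg[OF subalg h] .
  have hF: "h j \<in> borel_measurable (F t)" if "j \<le> t" for j t
    using borel_measurable_mono[OF that h] .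
  define S where "S n \<omega> = (\<Sum>j=m..<n. h j \<omega> * d j \<omega>)" for n \<omega>
  have SM [measurable]: "S n \<in> borel_measurable M" for n
    unfolding S_def by measurable
  have SF: "S n \<in> borel_measurable (F n)" for n
    unfolding S_def using hF borel_measurable_d'
    by (intro borel_measurable_sum borel_measurable_times) auto
  have le: "(h j \<omega> * d j \<omega>)\<^sup>2 \<le> (d j \<omega>)\<^sup>2" for j \<omega>
    using h1[of j \<omega>] by (simp add: power_mult_distrib mult_left_le_one_le abs_square_le_1)
  have hd: "integrable M (\<lambda>\<omega>. (h j \<omega> * d j \<omega>)\<^sup>2)" for j
    using square_integrable[of j] le by (rule_tac Bochner_Integration.integrable_bound) (auto intro!: AE_I2)
  have "integrable M (\<lambda>\<omega>. (S n \<omega>)\<^sup>2) \<and>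
    (\<integral>\<omega>. (S n \<omega>)\<^sup>2 \<partial>M) \<le> (\<Sum>j=m..<n. \<integral>\<omega>. (d j \<omega>)\<^sup>2 \<partial>M)"
    using \<open>m \<le> n\<close>
  proof (induction n rule: dec_induct)
    case base
    then show ?case by (simp add: S_def)
  next
    case (step n)
    \<comment> \<open>The factor of \<open>d n\<close> in the cross term of the expanded square; it
      is known at time \<open>n\<close>, so orthogonality applies.\<close>
    define f where "f \<omega> = S n \<omega> * h n \<omega>" for \<omega>
    have fF: "f \<in> borel_measurable (F n)"
      unfolding f_def using SF h by (intro borel_measurable_times) auto
    have [measurable]: "f \<in> borel_measurable M" unfolding f_def by measurable
    have "(f \<omega>)\<^sup>2 \<le> (S n \<omega>)\<^sup>2" for \<omega>
      using h1[of n \<omega>] by (simp add: f_def power_mult_distrib mult_right_le_one_le abs_square_le_1)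
    then have f2: "integrable M (\<lambda>\<omega>. (f \<omega>)\<^sup>2)"
      using step.IH by (rule_tac Bochner_Integration.integrable_bound[of _ "\<lambda>\<omega>. (S n \<omega>)\<^sup>2"]) (auto intro!: AE_I2)
    have fd: "integrable M (\<lambda>\<omega>. f \<omega> * d n \<omega>)"
      using f2 square_integrable by (intro integrable_mult_of_square_integrable) measurable
    have eq: "(S (Suc n) \<omega>)\<^sup>2 = (S n \<omega>)\<^sup>2 + 2 * (f \<omega> * d n \<omega>) + (h n \<omega> * d n \<omega>)\<^sup>2" for \<omega>
      using step.hyps by (simp add: S_def f_def power2_eq_square algebra_simps)
    have "integrable M (\<lambda>\<omega>. (S (Suc n) \<omega>)\<^sup>2)"
      unfolding eq using step.IH fd hd by simp
    moreover have "(\<integral>\<omega>. (S (Suc n) \<omega>)\<^sup>2 \<partial>M) =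
      (\<integral>\<omega>. (S n \<omega>)\<^sup>2 \<partial>M) + (\<integral>\<omega>. (h n \<omega> * d n \<omega>)\<^sup>2 \<partial>M)"
      unfolding eq using step.IH fd hd orthogonal[OF fF f2] by simp
    moreover have "(\<integral>\<omega>. (h n \<omega> * d n \<omega>)\<^sup>2 \<partial>M) \<le> (\<integral>\<omega>. (d n \<omega>)\<^sup>2 \<partial>M)"
      using hd square_integrable le by (intro integral_mono) auto
    ultimately show ?case using step by simp
  qed
  then show "integrable M (\<lambda>\<omega>. (\<Sum>j=m..<n. h j \<omega> * d j \<omega>)\<^sup>2)"
    "(\<integral>\<omega>. (\<Sum>j=m..<n. h j \<omega> * d j \<omega>)\<^sup>2 \<partial>M) \<le> (\<Sum>j=m..<n. \<integral>\<omega>. (d j \<omega>)\<^sup>2 \<partial>M)"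
    by (simp_all add: S_def)
qed

text \<open>Stopping the partial sums when they first reach \<open>\<epsilon>\<close> keeps them there, so Chebyshev's
  inequality for the single stopped sum at time \<open>n\<close> controls the maximum.\<close>
lemma maximal_inequality:
  assumes "0 < \<epsilon>" "m \<le> n"
  shows "prob {\<omega>\<in>space M. \<exists>k\<in>{m..n}. \<epsilon> \<le> \<bar>\<Sum>j=m..<k. d j \<omega>\<bar>} \<le>
    (\<Sum>j=m..<n. \<integral>\<omega>. (d j \<omega>)\<^sup>2 \<partial>M) / \<epsilon>\<^sup>2"
proof -
  define S where "S k \<omega> = (\<Sum>j=m..<k. d j \<omega>)" for k \<omega>
  have SM [measurable]: "S k \<in> borel_measurable M" for k unfolding S_def by measurable
  have SF: "S k \<in> borel_measurable (F t)" if "k \<le> t" for k t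
    unfolding S_def using that borel_measurable_d' by (intro borel_measurable_sum) auto
  \<comment> \<open>\<open>S j\<close> contains only increments with index below \<open>j\<close>,
    so testing it for inclusion of \<open>d j\<close> keeps \<open>h j\<close> measurable for
    \<open>F j\<close>.\<close>
  define h :: "nat \<Rightarrow> 'w \<Rightarrow> real"
    where "h j \<omega> = (if \<forall>k\<in>{m..j}. \<bar>S k \<omega>\<bar> < \<epsilon> then 1 else 0)" for j \<omega>
  have h: "h j \<in> borel_measurable (F j)" for j
  proof -
    have [measurable]: "S k \<in> borel_measurable (F j)" if "k \<in> {m..j}" for k
      using SF that by auto
    have "Measurable.pred (F j) (\<lambda>\<omega>. \<forall>k\<in>{m..j}. \<bar>S k \<omega>\<bar> < \<epsilon>)"
      by (intro pred_intros_finite) (auto intro!: borel_measurable_pred_less)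
    then show ?thesis unfolding h_def by measurable
  qed
  have [measurable]: "h j \<in> borel_measurable M" for j
    using measurable_from_subalg[OF subalg h] .
  define T where "T k \<omega> = (\<Sum>j=m..<k. h j \<omega> * d j \<omega>)" for k \<omega>
  have [measurable]: "T k \<in> borel_measurable M" for k unfolding T_def by measurable
  have T2: "integrable M (\<lambda>\<omega>. (T n \<omega>)\<^sup>2)"
    "(\<integral>\<omega>. (T n \<omega>)\<^sup>2 \<partial>M) \<le> (\<Sum>j=m..<n. \<integral>\<omega>. (d j \<omega>)\<^sup>2 \<partial>M)"
    using square_expectation_transform[OF h _ \<open>m \<le> n\<close>] by (auto simp: T_def h_def)
  have stopped: "\<epsilon> \<le> \<bar>T k \<omega>\<bar>" if that': "k0 \<in> {m..k}" "\<epsilon> \<le> \<bar>S k0 \<omega>\<bar>" for k k0 \<omega>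
  proof -
    \<comment> \<open>The first hitting time: all multipliers before \<open>i\<close> are 1 and all
      from \<open>i\<close> on are 0, so \<open>T k\<close> is frozen at \<open>S i\<close>.\<close>
    obtain i where i: "i \<in> {m..k}" "\<epsilon> \<le> \<bar>S i \<omega>\<bar>" "\<And>j. j \<in> {m..<i} \<Longrightarrow> \<bar>S j \<omega>\<bar> < \<epsilon>"
    proof (rule that[of "LEAST i. m \<le> i \<and> \<epsilon> \<le> \<bar>S i \<omega>\<bar>"])
      let ?P = "\<lambda>i. m \<le> i \<and> \<epsilon> \<le> \<bar>S i \<omega>\<bar>"
      have P: "?P k0" using that' by auto
      show "(LEAST i. ?P i) \<in> {m..k}"
        using LeastI[of ?P, OF P] Least_le[of ?P, OF P] that'(1) by auto
      show "\<epsilon> \<le> \<bar>S (LEAST i. ?P i) \<omega>\<bar>"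
        using LeastI[of ?P, OF P] by simp
      show "\<bar>S j \<omega>\<bar> < \<epsilon>" if "j \<in> {m..<LEAST i. ?P i}" for j
        using not_less_Least[of j ?P] that by auto
    qed
    have "T k \<omega> = (\<Sum>j=m..<i. h j \<omega> * d j \<omega>) + (\<Sum>j=i..<k. h j \<omega> * d j \<omega>)"
      using i(1) by (simp add: T_def sum.atLeastLessThan_concat)
    also have "(\<Sum>j=m..<i. h j \<omega> * d j \<omega>) = S i \<omega>"
      using i(3) by (auto simp: S_def h_def intro!: sum.cong)
    also have "(\<Sum>j=i..<k. h j \<omega> * d j \<omega>) = 0"
    proof (intro sum.neutral ballI)
      fix j assume "j \<in> {i..<k}"
      then have "\<exists>k\<in>{m..j}. \<not> \<bar>S k \<omega>\<bar> < \<epsilon>"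
        using i(1,2) by (intro bexI[of _ i]) auto
      then show "h j \<omega> * d j \<omega> = 0" unfolding h_def by auto
    qed
    finally show ?thesis using i(2) by simp
  qed
  have "prob {\<omega>\<in>space M. \<exists>k\<in>{m..n}. \<epsilon> \<le> \<bar>S k \<omega>\<bar>} \<le> prob {\<omega>\<in>space M. \<epsilon> \<le> \<bar>T n \<omega>\<bar>}"
    using stopped by (intro finite_measure_mono) auto
  also have "\<dots> \<le> (\<integral>\<omega>. (T n \<omega>)\<^sup>2 \<partial>M) / \<epsilon>\<^sup>2"
    using assms T2 by (intro second_moment_method) auto
  also have "\<dots> \<le> (\<Sum>j=m..<n. \<integral>\<omega>. (d j \<omega>)\<^sup>2 \<partial>M) / \<epsilon>\<^sup>2"
    using T2 by (intro divide_right_mono) auto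
  finally show ?thesis by (simp add: S_def)
qed

text \<open>A path violating the claim lies in every event \<open>B m\<close>. The probability of
  \<open>B m\<close> is controlled by the tail of the variance series from \<open>m\<close>, which
  tends to 0.\<close>

lemma AE_oscillation_less:
  assumes sm: "summable (\<lambda>t. \<integral>\<omega>. (d t \<omega>)\<^sup>2 \<partial>M)" and "0 < \<epsilon>"
  shows "AE \<omega> in M. \<exists>m. \<forall>n\<ge>m. \<bar>\<Sum>j=m..<n. d j \<omega>\<bar> < \<epsilon>"
proof -
  define v where "v t = (\<integral>\<omega>. (d t \<omega>)\<^sup>2 \<partial>M)" for t
  define E where "E m n = {\<omega>\<in>space M. \<exists>k\<in>{m..n}. \<epsilon> \<le> \<bar>\<Sum>j=m..<k. d j \<omega>\<bar>}" for m n
  define B where "B m = (\<Union>n\<in>{m..}. E m n)" for m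
  have E [measurable]: "E m n \<in> events" for m n unfolding E_def by measurable
  have B [measurable]: "B m \<in> events" for m unfolding B_def by measurable
  have bound: "prob (B m) \<le> (\<Sum>t. v (t + m)) / \<epsilon>\<^sup>2" for m
  proof (rule LIMSEQ_le_const2)
    \<comment> \<open>The events grow with the horizon, so continuity from below carries the
      finite-horizon bound to the infinite one.\<close>
    have "(\<Union>i. E m (m + i)) = B m"
      unfolding B_def by (fastforce simp: le_iff_add)
    then show "(\<lambda>i. prob (E m (m + i))) \<longlonglongrightarrow> prob (B m)"
      using finite_Lim_measure_incseq[of "\<lambda>i. E m (m + i)"] E
      by (fastforce simp: incseq_def E_def[abs_def])
    have "prob (E m (m + i)) \<le> (\<Sum>t. v (t + m)) / \<epsilon>\<^sup>2" for i
    proof -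
      have "prob (E m (m + i)) \<le> (\<Sum>j=m..<m+i. v j) / \<epsilon>\<^sup>2"
        unfolding E_def v_def using maximal_inequality[OF \<open>0 < \<epsilon>\<close>, of m "m + i"] by simp
      also have "(\<Sum>j=m..<m+i. v j) = (\<Sum>t<i. v (t + m))"
        using sum.shift_bounds_nat_ivl[of v 0 m i] by (simp add: add.commute lessThan_atLeast0)
      also have "\<dots> \<le> (\<Sum>t. v (t + m))"
        using sm by (intro sum_le_suminf) (auto simp: v_def summable_iff_shift[of v m, unfolded v_def])
      finally show ?thesis by (simp add: divide_right_mono)
    qed
    then show "\<exists>N. \<forall>n\<ge>N. prob (E m (m + n)) \<le> (\<Sum>t. v (t + m)) / \<epsilon>\<^sup>2" by blast
  qed
  have "prob (\<Inter>m. B m) \<le> 0"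
  proof (rule LIMSEQ_le_const)
    show "(\<lambda>m. (\<Sum>t. v (t + m)) / \<epsilon>\<^sup>2) \<longlonglongrightarrow> 0"
      using sm by (intro tendsto_divide_zero suminf_exist_split2) (simp add: v_def)
    have "prob (\<Inter>m. B m) \<le> (\<Sum>t. v (t + m)) / \<epsilon>\<^sup>2" for m
      using bound[of m] finite_measure_mono[of "\<Inter>m. B m" "B m"] by (auto intro: order.trans)
    then show "\<exists>N. \<forall>n\<ge>N. prob (\<Inter>m. B m) \<le> (\<Sum>t. v (t + n)) / \<epsilon>\<^sup>2" by blast
  qed
  then have "(\<Inter>m. B m) \<in> null_sets M"
    by (auto simp: null_sets_def emeasure_eq_measure measure_le_0_iff)
  then have "AE \<omega> in M. \<omega> \<notin> (\<Inter>m. B m)" by (rule AE_not_in)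
  with AE_space show ?thesis
  proof eventually_elim
    case (elim \<omega>)
    then obtain m where m: "\<omega> \<notin> B m" by auto
    have "\<bar>\<Sum>j=m..<n. d j \<omega>\<bar> < \<epsilon>" if "n \<ge> m" for n
    proof (rule ccontr)
      assume "\<not> \<bar>\<Sum>j=m..<n. d j \<omega>\<bar> < \<epsilon>"
      then have "\<omega> \<in> E m n" using elim(1) that by (auto simp: E_def not_less intro!: bexI[of _ n])
      with m that show False by (auto simp: B_def)
    qed
    then show ?case by blast
  qed
qed

text \<open>Countably many thresholds tending to 0 leave a single null set, outside which the
  partial sums are Cauchy.\<close>

theorem AE_convergent:
  assumes sm: "summable (\<lambda>t. \<integral>\<omega>. (d t \<omega>)\<^sup>2 \<partial>M)"
  shows "AE \<omega> in M. convergent (\<lambda>n. \<Sum>t<n. d t \<omega>)"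
proof -
  have "AE \<omega> in M. \<forall>i. \<exists>m. \<forall>n\<ge>m. \<bar>\<Sum>j=m..<n. d j \<omega>\<bar> < inverse (real (Suc i))"
    unfolding AE_all_countable using AE_oscillation_less[OF sm] by simp
  then show ?thesis
  proof eventually_elim
    case (elim \<omega>)
    have "Cauchy (\<lambda>n. \<Sum>t<n. d t \<omega>)"
    proof (rule CauchyI')
      fix e :: real assume "0 < e"
      then obtain i where i: "inverse (real (Suc i)) < e / 2"
        using reals_Archimedean[of "e/2"] by auto
      obtain m where m: "\<And>n. n \<ge> m \<Longrightarrow> \<bar>\<Sum>j=m..<n. d j \<omega>\<bar> < e / 2"
        using elim i by (meson less_trans)
      have "dist (\<Sum>t<a. d t \<omega>) (\<Sum>t<b. d t \<omega>) < e" if "a \<ge> m" "b > a" for a b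
      proof -
        have split: "(\<Sum>t<n. d t \<omega>) = (\<Sum>t<m. d t \<omega>) + (\<Sum>j=m..<n. d j \<omega>)" if "n \<ge> m" for n
          using that by (simp add: lessThan_atLeast0 sum.atLeastLessThan_concat)
        show ?thesis using split[of a] split[of b] m[of a] m[of b] that by (auto simp: dist_real_def)
      qed
      then show "\<exists>M. \<forall>m\<ge>M. \<forall>n>m. dist (\<Sum>t<m. d t \<omega>) (\<Sum>t<n. d t \<omega>) < e" by blast
    qed
    then show ?case by (simp add: Cauchy_convergent_iff)
  qed
qed

end

text \<open>The increments are cut off by a predictable criterion so that they are bounded and the
  squares of the cut-off steps sum to at most \<open>N\<close>; almost every path is unaffected for some \<open>N\<close>.\<close>
lemma AE_convergent_noise_series:
  fixes X :: "nat \<Rightarrow> 'w \<Rightarrow> 's::finite" and \<mu> :: "nat \<Rightarrow> 'w \<Rightarrow> 's pmf"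
    and v :: "nat \<Rightarrow> 's \<Rightarrow> 'w \<Rightarrow> real" and g :: "nat \<Rightarrow> 'w \<Rightarrow> real"
  assumes prob: "prob_space M" and filt: "filtration (space M) F"
    and subalg: "\<And>t. subalgebra M (F t)"
    and X: "\<And>t. X t \<in> F (Suc t) \<rightarrow>\<^sub>M count_space UNIV"
    and law: "\<And>t. has_cond_law M (F t) (X t) (\<mu> t)"
    and \<mu>: "\<And>t x. (\<lambda>\<omega>. pmf (\<mu> t \<omega>) x) \<in> borel_measurable (F t)"
    and v: "\<And>t x. v t x \<in> borel_measurable (F t)"
    and g: "\<And>t. g t \<in> borel_measurable (F t)"
    and g_square_sum: "AE \<omega> in M. summable (\<lambda>t. (g t \<omega>)\<^sup>2)"
    and v_bounded: "AE \<omega> in M. \<exists>B. \<forall>t x. \<bar>v t x \<omega>\<bar> \<le> B"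
  shows "AE \<omega> in M. convergent (\<lambda>n. \<Sum>t<n. g t \<omega> *
    (v t (X t \<omega>) \<omega> - (\<Sum>x\<in>UNIV. pmf (\<mu> t \<omega>) x * v t x \<omega>)))"
proof -
  interpret prob_space M by (rule prob)
  interpret filtration "space M" F by (rule filt)
  \<comment> \<open>The sum includes the current step \<open>g t\<close>, which is known at time
    \<open>t\<close>. The test on \<open>v\<close> runs over all states rather than the sampled one,
    which would not be known yet.\<close>
  define ok where "ok N t \<omega> \<longleftrightarrow> (\<Sum>k\<le>t. (g k \<omega>)\<^sup>2) \<le> N \<and> (\<forall>x. \<bar>v t x \<omega>\<bar> \<le> N)" for N :: real and t \<omega>
  define h where "h N t \<omega> = (if ok N t \<omega> then g t \<omega> else 0)" for N t \<omega>
  define c where "c N t x \<omega> = h N t \<omega> * v t x \<omega>" for N t x \<omega>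
  \<comment> \<open>Expanding the noise over centred indicators with coefficients known at time
    \<open>t\<close> reduces its conditional mean to the law on singletons, which is what
    \<open>has_cond_law\<close> provides.\<close>
  define J where "J t x \<omega> = indicat_real {\<omega>. X t \<omega> = x} \<omega> - pmf (\<mu> t \<omega>) x" for t x \<omega>
  define d where "d N t \<omega> = (\<Sum>x\<in>UNIV. c N t x \<omega> * J t x \<omega>)" for N t \<omega>
  have d_eq: "d N t \<omega> = h N t \<omega> * (v t (X t \<omega>) \<omega> - (\<Sum>x\<in>UNIV. pmf (\<mu> t \<omega>) x * v t x \<omega>))" for N t \<omega>
  proof -
    have "(\<Sum>x\<in>UNIV. indicat_real {\<omega>. X t \<omega> = x} \<omega> * v t x \<omega>) =
      (\<Sum>x\<in>UNIV. if x = X t \<omega> then v t x \<omega> else 0)"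
      by (intro sum.cong) (auto simp: indicator_def)
    then have eq: "v t (X t \<omega>) \<omega> = (\<Sum>x\<in>UNIV. indicat_real {\<omega>. X t \<omega> = x} \<omega> * v t x \<omega>)"
      by simp
    show ?thesis
      unfolding d_def c_def J_def eq sum_subtractf[symmetric] sum_distrib_left
      by (intro sum.cong) (simp_all only: algebra_simps)
  qed
  have gF: "g k \<in> borel_measurable (F t)" if "k \<le> t" for k t using borel_measurable_mono[OF that g] .
  have okF: "Measurable.pred (F t) (ok N t)" for N t
  proof -
    have [measurable]: "(\<lambda>\<omega>. \<Sum>k\<le>t. (g k \<omega>)\<^sup>2) \<in> borel_measurable (F t)"
      using gF by (intro borel_measurable_sum borel_measurable_power) auto
    note v[measurable]
    show ?thesis unfolding ok_def by measurable
  qed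
  have hF: "h N t \<in> borel_measurable (F t)" for N t
  proof -
    note okF[measurable] g[measurable]
    show ?thesis unfolding h_def by measurable
  qed
  have cF: "c N t x \<in> borel_measurable (F t)" for N t x
    unfolding c_def using hF v by (intro borel_measurable_times)
  have indF: "indicat_real {\<omega>. X t \<omega> = x} \<in> borel_measurable (F (Suc t))" for t x
    using measurable_sets[OF X[of t], of "{x}"]
    by (auto simp: borel_measurable_indicator_iff vimage_def Int_def)
  have JF: "J t x \<in> borel_measurable (F (Suc t))" for t x
    unfolding J_def using indF borel_measurable_mono[OF _ \<mu>, of t "Suc t"] by (intro borel_measurable_diff) auto
  have dF: "d N t \<in> borel_measurable (F (Suc t))" for N t
    unfolding d_def using borel_measurable_mono[OF _ cF, of t "Suc t"] JF
    by (intro borel_measurable_sum borel_measurable_times) auto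
  have M: "f \<in> borel_measurable M" if "f \<in> borel_measurable (F t)" for f :: "'w \<Rightarrow> real" and t
    using measurable_from_subalg[OF subalg that] .
  \<comment> \<open>\<open>ok\<close> may fail and hold again later. An index where it fails adds
    nothing; at one where it holds, the whole untruncated sum up to there is at most
    \<open>N\<close>.\<close>
  have h_sum: "(\<Sum>t<n. (h N t \<omega>)\<^sup>2) \<le> N" if "0 \<le> N" for N n \<omega>
  proof (induction n)
    case (Suc n)
    show ?case
    proof (cases "ok N n \<omega>")
      case True
      have "(\<Sum>t<Suc n. (h N t \<omega>)\<^sup>2) \<le> (\<Sum>t<Suc n. (g t \<omega>)\<^sup>2)"
        by (intro sum_mono) (simp add: h_def)
      also have "\<dots> \<le> N" using True by (simp add: ok_def lessThan_Suc_atMost)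
      finally show ?thesis .
    next
      case False
      then show ?thesis using Suc by (simp add: h_def)
    qed
  qed (use that in simp)
  have h_le: "\<bar>h N t \<omega>\<bar> \<le> sqrt N" if "0 \<le> N" for N t \<omega>
  proof (rule real_le_rsqrt)
    have "(h N t \<omega>)\<^sup>2 \<le> (\<Sum>k<Suc t. (h N k \<omega>)\<^sup>2)" by (intro member_le_sum) auto
    also have "\<dots> \<le> N" by (rule h_sum[OF that])
    finally show "\<bar>h N t \<omega>\<bar>\<^sup>2 \<le> N" by simp
  qed
  have c_le: "\<bar>c N t x \<omega>\<bar> \<le> \<bar>h N t \<omega>\<bar> * N" if "0 \<le> N" for N t x \<omega>
    using that by (cases "ok N t \<omega>") (auto simp: c_def h_def ok_def abs_mult intro!: mult_left_mono)
  have J_le: "\<bar>J t x \<omega>\<bar> \<le> 1" for t x \<omega>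
    using pmf_nonneg[of "\<mu> t \<omega>" x] pmf_le_1[of "\<mu> t \<omega>" x] by (auto simp: J_def indicator_def)
  \<comment> \<open>One summand per state, each at most \<open>N\<close> times the truncated
    step.\<close>
  define K where "K N = real CARD('s) * N" for N
  have d_le: "\<bar>d N t \<omega>\<bar> \<le> \<bar>h N t \<omega>\<bar> * K N" if "0 \<le> N" for N t \<omega>
  proof -
    have "\<bar>c N t x \<omega> * J t x \<omega>\<bar> \<le> (\<bar>h N t \<omega>\<bar> * N) * 1" for x
      unfolding abs_mult using c_le[OF that, of t x \<omega>] J_le[of t x \<omega>] that
      by (intro mult_mono) auto
    then have "\<bar>d N t \<omega>\<bar> \<le> (\<Sum>x\<in>(UNIV::'s set). (\<bar>h N t \<omega>\<bar> * N) * 1)"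
      unfolding d_def by (intro order.trans[OF sum_abs] sum_mono)
    then show ?thesis by (simp add: K_def mult_ac)
  qed
  have d2_le: "(d N t \<omega>)\<^sup>2 \<le> (K N)\<^sup>2 * (h N t \<omega>)\<^sup>2" if "0 \<le> N" for N t \<omega>
    using power_mono[OF d_le[OF that, of t \<omega>], of 2] by (simp add: power_mult_distrib mult.commute)
  have cJ_int: "integrable M (\<lambda>\<omega>. c N t x \<omega> * J t x \<omega>)" if "0 \<le> N" for N t x
  proof (rule integrable_const_bound)
    show "AE \<omega> in M. norm (c N t x \<omega> * J t x \<omega>) \<le> sqrt N * N * 1"
    proof (intro AE_I2)
      fix \<omega>
      have "\<bar>c N t x \<omega>\<bar> \<le> sqrt N * N"
        using c_le[OF that, of t x \<omega>] mult_right_mono[OF h_le[OF that, of t \<omega>] that] by linarith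
      then show "norm (c N t x \<omega> * J t x \<omega>) \<le> sqrt N * N * 1"
        unfolding real_norm_def abs_mult using J_le that by (intro mult_mono) auto
    qed
    show "(\<lambda>\<omega>. c N t x \<omega> * J t x \<omega>) \<in> borel_measurable M"
      by (intro borel_measurable_times M[OF cF] M[OF JF])
  qed
  have cond: "AE \<omega> in M. real_cond_exp M (F t) (d N t) \<omega> = 0" if N: "0 \<le> N" for N t
  proof -
    interpret finite_measure_subalgebra M "F t"
      using subalg by unfold_locales
    have J0: "AE \<omega> in M. real_cond_exp M (F t) (J t x) \<omega> = 0" for x
    proof -
      have i1: "integrable M (indicat_real {\<omega>. X t \<omega> = x})"
        using M[OF indF] by (intro integrable_const_bound[of _ 1]) (auto simp: indicator_def)
      have i2: "integrable M (\<lambda>\<omega>. pmf (\<mu> t \<omega>) x)"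
        using M[OF \<mu>] by (intro integrable_const_bound[of _ 1]) (auto simp: pmf_le_1)
      have "AE \<omega> in M. real_cond_exp M (F t) (indicat_real {\<omega>. X t \<omega> = x}) \<omega> = pmf (\<mu> t \<omega>) x"
        using law[of t] by (simp add: has_cond_law_def)
      moreover have "AE \<omega> in M. real_cond_exp M (F t) (J t x) \<omega> =
        real_cond_exp M (F t) (indicat_real {\<omega>. X t \<omega> = x}) \<omega>
          - real_cond_exp M (F t) (\<lambda>\<omega>. pmf (\<mu> t \<omega>) x) \<omega>"
        using real_cond_exp_diff[OF i1 i2] by (simp only: J_def[abs_def])
      moreover have "AE \<omega> in M. real_cond_exp M (F t) (\<lambda>\<omega>. pmf (\<mu> t \<omega>) x) \<omega> = pmf (\<mu> t \<omega>) x"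
        by (rule real_cond_exp_F_meas[OF i2 \<mu>])
      ultimately show ?thesis by eventually_elim simp
    qed
    have "AE \<omega> in M. \<forall>x\<in>UNIV. real_cond_exp M (F t) (\<lambda>\<omega>. c N t x \<omega> * J t x \<omega>) \<omega> = 0"
    proof (rule AE_finite_allI)
      fix x
      show "AE \<omega> in M. real_cond_exp M (F t) (\<lambda>\<omega>. c N t x \<omega> * J t x \<omega>) \<omega> = 0"
        using real_cond_exp_mult[OF cF[of N t x] M[OF JF] cJ_int[OF N, of t x]] J0[of x]
        by eventually_elim simp
    qed simp
    moreover have "AE \<omega> in M. real_cond_exp M (F t) (\<lambda>\<omega>. \<Sum>x\<in>UNIV. c N t x \<omega> * J t x \<omega>) \<omega> =
      (\<Sum>x\<in>UNIV. real_cond_exp M (F t) (\<lambda>\<omega>. c N t x \<omega> * J t x \<omega>) \<omega>)"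
      using cJ_int[OF N] by (intro real_cond_exp_sum)
    ultimately show ?thesis
      unfolding d_def[abs_def] by eventually_elim simp
  qed
  \<comment> \<open>Summing inside the integral uses the pathwise bound \<open>h_sum\<close>, so all
    partial sums of variances stay below \<open>(K N)\<^sup>2 * N\<close>.\<close>
  have conv: "AE \<omega> in M. convergent (\<lambda>n. \<Sum>t<n. d N t \<omega>)" if N: "0 \<le> N" for N
  proof -
    have d2_int: "integrable M (\<lambda>\<omega>. (d N t \<omega>)\<^sup>2)" for t
    proof (rule integrable_const_bound)
      show "AE \<omega> in M. norm ((d N t \<omega>)\<^sup>2) \<le> (K N)\<^sup>2 * N"
      proof (intro AE_I2)
        fix \<omega>
        have "\<bar>h N t \<omega>\<bar>\<^sup>2 \<le> (sqrt N)\<^sup>2" by (intro power_mono h_le N) simp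
        then have "(K N)\<^sup>2 * (h N t \<omega>)\<^sup>2 \<le> (K N)\<^sup>2 * N" using N by (intro mult_left_mono) auto
        then show "norm ((d N t \<omega>)\<^sup>2) \<le> (K N)\<^sup>2 * N" using d2_le[OF N, of t \<omega>] by simp
      qed
    qed (intro borel_measurable_power M[OF dF])
    interpret L2_martingale_differences M F "d N"
      using subalg dF d2_int cond[OF N] by unfold_locales
    have "summable (\<lambda>t. \<integral>\<omega>. (d N t \<omega>)\<^sup>2 \<partial>M)"
    proof (rule summableI_nonneg_bounded)
      fix n
      have "(\<Sum>t<n. \<integral>\<omega>. (d N t \<omega>)\<^sup>2 \<partial>M) = (\<integral>\<omega>. (\<Sum>t<n. (d N t \<omega>)\<^sup>2) \<partial>M)"
        using d2_int by simp
      also have "\<dots> \<le> (\<integral>\<omega>. (K N)\<^sup>2 * N \<partial>M)"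
      proof (intro integral_mono)
        fix \<omega>
        have "(\<Sum>t<n. (d N t \<omega>)\<^sup>2) \<le> (K N)\<^sup>2 * (\<Sum>t<n. (h N t \<omega>)\<^sup>2)"
          unfolding sum_distrib_left by (intro sum_mono d2_le N)
        also have "\<dots> \<le> (K N)\<^sup>2 * N" using h_sum[OF N] by (intro mult_left_mono) auto
        finally show "(\<Sum>t<n. (d N t \<omega>)\<^sup>2) \<le> (K N)\<^sup>2 * N" .
      qed (use d2_int in auto)
      finally show "(\<Sum>t<n. \<integral>\<omega>. (d N t \<omega>)\<^sup>2 \<partial>M) \<le> (K N)\<^sup>2 * N" by (simp add: prob_space)
    qed simp
    then show ?thesis by (rule AE_convergent)
  qed
  have "AE \<omega> in M. \<forall>N::nat. convergent (\<lambda>n. \<Sum>t<n. d (real N) t \<omega>)"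
    unfolding AE_all_countable using conv by simp
  with g_square_sum v_bounded show ?thesis
  proof eventually_elim
    case (elim \<omega>)
    obtain B where B: "\<And>t x. \<bar>v t x \<omega>\<bar> \<le> B" using elim(2) by blast
    \<comment> \<open>Above both path-dependent bounds the truncation never acts on this
      path.\<close>
    obtain N :: nat where N: "max B (\<Sum>t. (g t \<omega>)\<^sup>2) \<le> real N"
      using real_arch_simple by blast
    have "ok (real N) t \<omega>" for t
    proof -
      have "(\<Sum>k\<le>t. (g k \<omega>)\<^sup>2) \<le> (\<Sum>t. (g t \<omega>)\<^sup>2)"
        using elim(1) by (intro sum_le_suminf) auto
      moreover have "\<bar>v t x \<omega>\<bar> \<le> real N" for x
        using B[of t x] N by simp
      ultimately show ?thesis using N by (simp add: ok_def)
    qed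
    then have "h (real N) t \<omega> = g t \<omega>" for t by (simp add: h_def)
    then show ?case using spec[OF elim(3), of N] by (simp add: d_eq)
  qed
qed

section \<open>Asynchronous stochastic approximation\<close>

text \<open>The excess of \<open>\<bar>a t\<bar>\<close> over \<open>B\<close> shrinks by a factor
  \<open>1 - g t\<close>, at most \<open>exp (- g t)\<close>, and the product of these factors tends
  to 0 because the steps have infinite sum.\<close>

lemma eventually_le_relaxation:
  fixes a b g :: "nat \<Rightarrow> real"
  assumes g: "\<forall>\<^sub>F t in sequentially. 0 \<le> g t \<and> g t \<le> 1"
    and g_sum: "filterlim (\<lambda>n. \<Sum>t<n. g t) at_top sequentially"
    and step: "\<And>t. a (Suc t) = (1 - g t) * a t + g t * b t"
    and b: "\<forall>\<^sub>F t in sequentially. \<bar>b t\<bar> \<le> B"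
    and "0 < \<epsilon>"
  shows "\<forall>\<^sub>F t in sequentially. \<bar>a t\<bar> \<le> B + \<epsilon>"
proof -
  obtain T where T: "\<And>t. t \<ge> T \<Longrightarrow> 0 \<le> g t \<and> g t \<le> 1 \<and> \<bar>b t\<bar> \<le> B"
    using eventually_conj[OF g b] by (auto simp: eventually_sequentially)
  define G where "G n = (\<Sum>t<n. g t)" for n
  \<comment> \<open>The positive part keeps the excess nonnegative, so that the factor
    \<open>1 - g t\<close> can be enlarged to an exponential.\<close>
  define u where "u t = max 0 (\<bar>a t\<bar> - B)" for t
  have u_step: "u (Suc t) \<le> exp (- g t) * u t" if "t \<ge> T" for t
  proof -
    have "\<bar>a (Suc t)\<bar> \<le> (1 - g t) * \<bar>a t\<bar> + g t * \<bar>b t\<bar>"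
      using T[OF that] abs_triangle_ineq[of "(1 - g t) * a t" "g t * b t"]
      by (simp add: step abs_mult)
    also have "g t * \<bar>b t\<bar> \<le> g t * B"
      using T[OF that] by (intro mult_left_mono) auto
    finally have "\<bar>a (Suc t)\<bar> - B \<le> (1 - g t) * (\<bar>a t\<bar> - B)"
      by (simp add: algebra_simps)
    also have "\<dots> \<le> (1 - g t) * u t"
      using T[OF that] by (intro mult_left_mono) (auto simp: u_def)
    finally have "u (Suc t) \<le> (1 - g t) * u t"
      using T[OF that] by (auto simp: u_def)
    also have "\<dots> \<le> exp (- g t) * u t"
      using exp_ge_add_one_self[of "- g t"] by (intro mult_right_mono) (auto simp: u_def)
    finally show ?thesis .
  qed
  have u_le: "u t \<le> exp (G T - G t) * u T" if "t \<ge> T" for t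
    using that
  proof (induction t rule: dec_induct)
    case (step t)
    have "u (Suc t) \<le> exp (- g t) * (exp (G T - G t) * u T)"
      using u_step[OF step.hyps(1)] step.IH by (meson exp_ge_zero mult_left_mono order.trans)
    also have "\<dots> = exp (G T - G (Suc t)) * u T"
      by (simp add: G_def mult_exp_exp algebra_simps flip: mult.assoc)
    finally show ?case .
  qed simp
  have "filterlim (\<lambda>t. - G T + G t) at_top sequentially"
    using g_sum unfolding G_def by (rule filterlim_tendsto_add_at_top[OF tendsto_const])
  then have "((\<lambda>t. exp (- (- G T + G t)) * u T) \<longlongrightarrow> 0 * u T) sequentially"
    by (intro tendsto_intros filterlim_compose[OF exp_at_bot])
       (simp only: filterlim_uminus_at_top[symmetric])
  then have "\<forall>\<^sub>F t in sequentially. exp (G T - G t) * u T < \<epsilon>"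
    using \<open>0 < \<epsilon>\<close> by (intro order_tendstoD(2)) auto
  with eventually_ge_at_top[of T] show ?thesis
  proof eventually_elim
    case (elim t)
    then show ?case using u_le[of t] by (simp add: u_def)
  qed
qed

text \<open>Once the steps are at most 1 each update is a convex combination, and the interval from
  \<open>-B\<close> to \<open>B\<close> is invariant as soon as
  \<open>c + \<beta> * B \<le> B\<close>.\<close>

lemma bounded_relaxation:
  fixes x y g :: "nat \<Rightarrow> 'i::finite \<Rightarrow> real"
  assumes \<beta>: "0 \<le> \<beta>" "\<beta> < 1"
    and g: "\<And>i. \<forall>\<^sub>F t in sequentially. 0 \<le> g t i \<and> g t i \<le> 1"
    and step: "\<And>t i. x (Suc t) i = (1 - g t i) * x t i + g t i * y t i"
    and y: "\<And>t i D. (\<And>j. \<bar>x t j\<bar> \<le> D) \<Longrightarrow> \<bar>y t i\<bar> \<le> c + \<beta> * D"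
  shows "\<exists>B. \<forall>t i. \<bar>x t i\<bar> \<le> B"
proof -
  have "\<forall>\<^sub>F t in sequentially. \<forall>i. 0 \<le> g t i \<and> g t i \<le> 1"
    using g by (intro eventually_all_finite) auto
  then obtain T where T: "\<And>t i. t \<ge> T \<Longrightarrow> 0 \<le> g t i \<and> g t i \<le> 1"
    by (auto simp: eventually_sequentially)
  \<comment> \<open>\<open>K\<close> covers the times up to \<open>T\<close>, before which a step
    may exceed 1; \<open>c / (1 - \<beta>)\<close> is the least \<open>B\<close> with
    \<open>c + \<beta> * B \<le> B\<close>.\<close>
  define K where "K = (\<Sum>t\<le>T. \<Sum>i\<in>UNIV. \<bar>x t i\<bar>)"
  define B where "B = max K (c / (1 - \<beta>))"
  have init: "\<bar>x t i\<bar> \<le> B" if "t \<le> T" for t i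
  proof -
    have "\<bar>x t i\<bar> \<le> (\<Sum>i\<in>UNIV. \<bar>x t i\<bar>)"
      by (intro member_le_sum) auto
    also have "\<dots> \<le> K"
      unfolding K_def using that by (intro member_le_sum[of t _ "\<lambda>t. \<Sum>i\<in>UNIV. \<bar>x t i\<bar>"]) (auto intro: sum_nonneg)
    finally show ?thesis by (simp add: B_def)
  qed
  have B: "c + \<beta> * B \<le> B"
  proof -
    have "c / (1 - \<beta>) \<le> B" by (simp add: B_def)
    then have "c \<le> B * (1 - \<beta>)" using \<beta> by (simp add: pos_divide_le_eq)
    then show ?thesis by (simp add: algebra_simps)
  qed
  have "\<forall>i. \<bar>x t i\<bar> \<le> B" if "T \<le> t" for t
    using that
  proof (induction t rule: dec_induct)
    case base
    then show ?case using init by simp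
  next
    case (step t)
    show ?case
    proof
      fix i
      have "\<bar>x (Suc t) i\<bar> \<le> (1 - g t i) * \<bar>x t i\<bar> + g t i * \<bar>y t i\<bar>"
        using T[OF step.hyps(1), of i] abs_triangle_ineq[of "(1 - g t i) * x t i" "g t i * y t i"]
        by (simp add: assms(4) abs_mult)
      also have "\<dots> \<le> (1 - g t i) * B + g t i * B"
        using T[OF step.hyps(1), of i] step.IH y[of t B i] B
        by (intro add_mono mult_left_mono) auto
      finally show "\<bar>x (Suc t) i\<bar> \<le> B" by (simp add: algebra_simps)
    qed
  qed
  then show ?thesis using init by (metis nat_le_linear)
qed

text \<open>Subtracting the tail of the noise series turns the noise into a vanishing perturbation;
  each bound on the error then improves by any factor strictly between \<open>\<beta>\<close> and \<open>1\<close>.\<close>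
lemma asynchronous_contraction_tendsto_zero:
  fixes x f w g :: "nat \<Rightarrow> 'i::finite \<Rightarrow> real"
  assumes \<beta>: "0 \<le> \<beta>" "\<beta> < 1"
    and g: "\<And>i. \<forall>\<^sub>F t in sequentially. 0 \<le> g t i \<and> g t i \<le> 1"
    and g_sum: "\<And>i. filterlim (\<lambda>n. \<Sum>t<n. g t i) at_top sequentially"
    and step: "\<And>t i. x (Suc t) i = (1 - g t i) * x t i + g t i * (f t i + w t i)"
    and f: "\<And>t i D. (\<And>j. \<bar>x t j\<bar> \<le> D) \<Longrightarrow> \<bar>f t i\<bar> \<le> \<beta> * D"
    and noise: "\<And>i. convergent (\<lambda>n. \<Sum>t<n. g t i * w t i)"
    and bounded: "\<And>t i. \<bar>x t i\<bar> \<le> B"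
  shows "(\<lambda>t. x t i) \<longlonglongrightarrow> 0"
proof -
  define S where "S i n = (\<Sum>t<n. g t i * w t i)" for i n
  \<comment> \<open>Minus the tail of the noise series. Its increment is exactly the weighted noise,
    so \<open>x - e\<close> follows the recursion with the noisy target replaced by
    \<open>f - e\<close>.\<close>
  define e where "e t i = S i t - lim (S i)" for t i
  have e: "(\<lambda>t. e t i) \<longlonglongrightarrow> 0" for i
    using noise[of i] unfolding e_def S_def
    by (intro LIM_zero) (simp add: convergent_LIMSEQ_iff)
  define \<rho> where "\<rho> = (1 + \<beta>) / 2"
  have \<rho>: "0 < \<rho>" "\<rho> < 1" "\<beta> < \<rho>" using \<beta> by (auto simp: \<rho>_def)
  have improve: "\<forall>\<^sub>F t in sequentially. \<forall>i. \<bar>x t i\<bar> \<le> \<rho> * D"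
    if D: "0 < D" and ev: "\<forall>\<^sub>F t in sequentially. \<forall>i. \<bar>x t i\<bar> \<le> D" for D
  proof (rule eventually_all_finite)
    fix i
    \<comment> \<open>The gap between \<open>\<beta> * D\<close> and \<open>\<rho> * D\<close> is
      spent in thirds: on \<open>e\<close> in the target, on the slack of the relaxation, and on
      returning from \<open>x - e\<close> to \<open>x\<close>.\<close>
    define \<delta> where "\<delta> = (\<rho> - \<beta>) * D / 3"
    have \<delta>: "0 < \<delta>" using \<rho> D by (simp add: \<delta>_def)
    have e_le: "\<forall>\<^sub>F t in sequentially. \<bar>e t i\<bar> \<le> \<delta>"
      using tendstoD[OF e \<delta>, of i] by (auto elim!: eventually_mono)
    have "\<forall>\<^sub>F t in sequentially. \<bar>x t i - e t i\<bar> \<le> (\<beta> * D + \<delta>) + \<delta>"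
    proof (rule eventually_le_relaxation[OF g g_sum])
      show "x (Suc t) i - e (Suc t) i = (1 - g t i) * (x t i - e t i) + g t i * (f t i - e t i)" for t
        by (simp add: step e_def S_def algebra_simps)
      show "\<forall>\<^sub>F t in sequentially. \<bar>f t i - e t i\<bar> \<le> \<beta> * D + \<delta>"
        using ev e_le
      proof eventually_elim
        case (elim t)
        then show ?case using f[of t D i] by auto
      qed
    qed fact
    with e_le show "\<forall>\<^sub>F t in sequentially. \<bar>x t i\<bar> \<le> \<rho> * D"
    proof eventually_elim
      case (elim t)
      then have "\<bar>x t i\<bar> \<le> \<beta> * D + 3 * \<delta>" by linarith
      also have "\<dots> = \<rho> * D" by (simp add: \<delta>_def field_simps)
      finally show ?case .
    qed
  qed
  \<comment> \<open>The 1 keeps the bound positive, as each round of improvement requires.\<close>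
  define C where "C = max B 1"
  have C: "0 < C" by (simp add: C_def)
  have powers: "\<forall>\<^sub>F t in sequentially. \<forall>i. \<bar>x t i\<bar> \<le> \<rho> ^ n * C" for n
  proof (induction n)
    case 0
    have "\<bar>x t i\<bar> \<le> C" for t i using bounded[of t i] by (simp add: C_def)
    then show ?case by simp
  next
    case (Suc n)
    then show ?case using improve[of "\<rho> ^ n * C"] \<rho> C by (simp add: mult.assoc)
  qed
  show ?thesis
  proof (rule tendstoI)
    fix \<epsilon> :: real assume "0 < \<epsilon>"
    obtain n where "\<rho> ^ n < \<epsilon> / C"
      using real_arch_pow_inv[of "\<epsilon> / C" \<rho>] \<rho> C \<open>0 < \<epsilon>\<close> by auto
    then have n: "\<rho> ^ n * C < \<epsilon>" using C by (simp add: pos_less_divide_eq)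
    show "\<forall>\<^sub>F t in sequentially. dist (x t i) 0 < \<epsilon>"
      using powers[of n] by eventually_elim (use n in \<open>auto intro: le_less_trans\<close>)
  qed
qed

section \<open>The Bellman operator\<close>

lemma abs_Max_diff_le:
  fixes f g :: "'a::finite \<Rightarrow> real"
  assumes "\<And>b. \<bar>f b - g b\<bar> \<le> D"
  shows "\<bar>(MAX b\<in>UNIV. f b) - (MAX b\<in>UNIV. g b)\<bar> \<le> D"
proof -
  have "(MAX b\<in>UNIV. u b) \<le> (MAX b\<in>UNIV. v b) + D"
    if "\<And>b. \<bar>u b - v b\<bar> \<le> D" for u v :: "'a \<Rightarrow> real"
  proof (subst Max_le_iff; safe?)
    fix b
    have "v b \<le> (MAX b\<in>UNIV. v b)" by simp
    then show "u b \<le> (MAX b\<in>UNIV. v b) + D" using that[of b] by linarith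
  qed auto
  from this[of f g] this[of g f] show ?thesis
    using assms by (smt (verit))
qed

lemma abs_Max_le:
  fixes f :: "'a::finite \<Rightarrow> real"
  assumes "\<And>b. \<bar>f b\<bar> \<le> D"
  shows "\<bar>MAX b\<in>UNIV. f b\<bar> \<le> D"
proof -
  have "Max (range f) \<in> range f" by (intro Max_in) auto
  then obtain b where "Max (range f) = f b" by blast
  then show ?thesis by (simp only: assms)
qed

lemma sum_pmf_eq_1_finite: "(\<Sum>x\<in>UNIV. pmf p x) = 1" for p :: "'s::finite pmf"
  using sum_pmf_eq_1[of UNIV p] by simp

text \<open>The rewards cancel, taking maxima is nonexpansive, and averaging with weights of total 1
  cannot enlarge a bound.\<close>

lemma bellman_contraction:
  assumes "0 \<le> \<beta>" and "\<And>s a. \<bar>Q s a - Q' s a\<bar> \<le> D"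
  shows "\<bar>bellman p R \<beta> Q s a - bellman p R \<beta> Q' s a\<bar> \<le> \<beta> * D"
proof -
  have "\<bar>bellman p R \<beta> Q s a - bellman p R \<beta> Q' s a\<bar> =
    \<bar>\<Sum>s'\<in>UNIV. pmf (p s a) s' * (\<beta> * ((MAX b\<in>UNIV. Q s' b) - (MAX b\<in>UNIV. Q' s' b)))\<bar>"
    unfolding bellman_def by (simp add: sum_subtractf[symmetric] algebra_simps)
  also have "\<dots> \<le> (\<Sum>s'\<in>UNIV. pmf (p s a) s' * (\<beta> * D))"
    using assms abs_Max_diff_le[of "Q _" "Q' _" D]
    by (intro order.trans[OF sum_abs] sum_mono) (auto simp: abs_mult intro!: mult_left_mono)
  also have "\<dots> = \<beta> * D" by (simp add: sum_pmf_eq_1_finite flip: sum_distrib_right)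
  finally show ?thesis .
qed

lemma bellman_fixpoint_unique:
  assumes "0 \<le> \<beta>" "\<beta> < 1" and Q: "bellman p R \<beta> Q = Q" and Q': "bellman p R \<beta> Q' = Q'"
  shows "Q = Q'"
proof -
  define D where "D = (MAX (s, a)\<in>UNIV. \<bar>Q s a - Q' s a\<bar>)"
  have le: "\<bar>Q s a - Q' s a\<bar> \<le> D" for s a
    unfolding D_def by (rule Max_ge) (auto intro: range_eqI[of _ _ "(s, a)"])
  have "\<bar>Q s a - Q' s a\<bar> \<le> \<beta> * D" for s a
    using bellman_contraction[of \<beta> Q Q' D p R s a] assms(1) le by (simp add: Q Q')
  then have "D \<le> \<beta> * D"
    unfolding D_def[abs_def] by (subst (1) Max_le_iff) auto
  then have "D \<le> 0"
    using assms(2) by (smt (verit) mult_less_cancel_right2)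
  then have "Q s a = Q' s a" for s a using le[of s a] by auto
  then show ?thesis by (intro ext)
qed

text \<open>Picard iteration from the zero function: increments decay geometrically, so each
  component converges by telescoping, and the contraction passes the recursion to the limit.\<close>

lemma bellman_fixpoint_exists:
  fixes p :: "'s::finite \<Rightarrow> 'a::finite \<Rightarrow> 's pmf" and R :: "'s \<Rightarrow> 'a \<Rightarrow> 's \<Rightarrow> real"
  assumes "0 \<le> \<beta>" "\<beta> < 1"
  shows "\<exists>Q. bellman p R \<beta> Q = Q"
proof -
  define q where "q n = (bellman p R \<beta> ^^ n) (\<lambda>_ _. 0)" for n
  have q_Suc: "q (Suc n) = bellman p R \<beta> (q n)" for n by (simp add: q_def)
  define C where "C = (\<Sum>s\<in>UNIV. \<Sum>a\<in>UNIV. \<bar>q 1 s a - q 0 s a\<bar>)"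
  have le_sum: "\<bar>h s a\<bar> \<le> (\<Sum>s\<in>UNIV. \<Sum>a\<in>UNIV. \<bar>h s a\<bar>)" for h :: "'s \<Rightarrow> 'a \<Rightarrow> real" and s a
    using member_le_sum[of a UNIV "\<lambda>a. \<bar>h s a\<bar>"]
      member_le_sum[of s UNIV "\<lambda>s. \<Sum>a\<in>UNIV. \<bar>h s a\<bar>"] by (auto simp: sum_nonneg)
  have diff: "\<bar>q (Suc n) s a - q n s a\<bar> \<le> \<beta> ^ n * C" for n s a
  proof (induction n arbitrary: s a)
    case 0
    then show ?case using le_sum[of "\<lambda>s a. q 1 s a - q 0 s a"] by (simp add: C_def)
  next
    case (Suc n)
    then show ?case
      using bellman_contraction[of \<beta> "q (Suc n)" "q n" "\<beta> ^ n * C" p R s a] assms(1)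
      by (simp add: q_Suc mult.assoc)
  qed
  have sm: "summable (\<lambda>n. q (Suc n) s a - q n s a)" for s a
  proof (rule summable_comparison_test')
    show "summable (\<lambda>n. \<beta> ^ n * C)"
      using assms by (intro summable_mult2 summable_geometric) simp
    show "norm (q (Suc n) s a - q n s a) \<le> \<beta> ^ n * C" for n
      using diff[of n s a] by (simp only: real_norm_def)
  qed
  have "convergent (\<lambda>n. q n s a - q 0 s a)" for s a
    using sm[of s a] sum_lessThan_telescope[of "\<lambda>n. q n s a"] by (simp only: summable_iff_convergent)
  then have "convergent (\<lambda>n. (q n s a - q 0 s a) + q 0 s a)" for s a
    by (intro convergent_add convergent_const)
  then have "\<exists>l. (\<lambda>n. q n s a) \<longlonglongrightarrow> l" for s a
    by (simp add: convergent_def)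
  then obtain L where L: "\<And>s a. (\<lambda>n. q n s a) \<longlonglongrightarrow> L s a" by metis
  have "bellman p R \<beta> L s a = L s a" for s a
  proof (rule LIMSEQ_unique)
    \<comment> \<open>A sum over the finitely many pairs dominates the maximum norm and inherits
      convergence to 0 from the components.\<close>
    define D where "D n = (\<Sum>s\<in>UNIV. \<Sum>a\<in>UNIV. \<bar>q n s a - L s a\<bar>)" for n
    have "D \<longlonglongrightarrow> (\<Sum>s\<in>(UNIV::'s set). \<Sum>a\<in>(UNIV::'a set). 0)"
      unfolding D_def using L by (intro tendsto_sum tendsto_rabs_zero LIM_zero)
    then have null: "(\<lambda>n. \<beta> * D n) \<longlonglongrightarrow> 0"
      using tendsto_mult_right_zero by auto
    have le: "norm (q (Suc n) s a - bellman p R \<beta> L s a) \<le> \<beta> * D n" for n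
      unfolding q_Suc D_def real_norm_def using le_sum[of "\<lambda>s a. q n s a - L s a"]
      by (intro bellman_contraction[OF assms(1)])
    have "(\<lambda>n. q (Suc n) s a - bellman p R \<beta> L s a) \<longlonglongrightarrow> 0"
      by (rule Lim_null_comparison[OF always_eventually null]) (rule allI, rule le)
    then show "(\<lambda>n. q (Suc n) s a) \<longlonglongrightarrow> bellman p R \<beta> L s a"
      by (rule LIM_zero_cancel)
    show "(\<lambda>n. q (Suc n) s a) \<longlonglongrightarrow> L s a"
      using L[of s a] by (rule LIMSEQ_Suc)
  qed
  then show ?thesis by blast
qed

text \<open>\<open>Q_star\<close> is a definite description, so its fixed-point equation rests on
  existence together with uniqueness.\<close>

lemma bellman_Q_star:
  assumes "0 \<le> \<beta>" "\<beta> < 1"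
  shows "bellman p R \<beta> (Q_star p R \<beta>) = Q_star p R \<beta>"
  unfolding Q_star_def
proof (rule theI'[of "\<lambda>Q. bellman p R \<beta> Q = Q"], rule ex_ex1I)
  show "\<exists>Q. bellman p R \<beta> Q = Q" by (rule bellman_fixpoint_exists[OF assms])
  show "Q = Q'" if "bellman p R \<beta> Q = Q" "bellman p R \<beta> Q' = Q'" for Q Q'
    by (rule bellman_fixpoint_unique[OF assms that])
qed

section \<open>Convergence of Q-learning\<close>

theorem theorem4p5:
  fixes M :: "'w measure"
    and F :: "nat \<Rightarrow> 'w measure"
    and p :: "'s::finite \<Rightarrow> 'a::finite \<Rightarrow> 's pmf"
    and R :: "'s \<Rightarrow> 'a \<Rightarrow> 's \<Rightarrow> real"
    and \<beta> :: real
    and Q\<^sub>0 :: "'s \<Rightarrow> 'a \<Rightarrow> real"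
    and st :: "nat \<Rightarrow> 'w \<Rightarrow> 's"
    and act :: "nat \<Rightarrow> 'w \<Rightarrow> 'a"
    and X :: "nat \<Rightarrow> 'w \<Rightarrow> 's"
    and \<gamma> :: "nat \<Rightarrow> 's \<Rightarrow> 'a \<Rightarrow> 'w \<Rightarrow> real"
    and Q :: "nat \<Rightarrow> 'w \<Rightarrow> 's \<Rightarrow> 'a \<Rightarrow> real"
  assumes discount: "0 < \<beta>" "\<beta> < 1"
    and prob: "prob_space M"
    and filt: "filtration (space M) F"
    and subalg: "\<And>t. subalgebra M (F t)"
    and pair_measurable: "\<And>t. (\<lambda>\<omega>. (st t \<omega>, act t \<omega>)) \<in> F t \<rightarrow>\<^sub>M count_space UNIV"
    and step_measurable: "\<And>t s a. \<gamma> t s a \<in> borel_measurable (F t)"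
    and step_nonneg: "\<And>t s a \<omega>. \<omega> \<in> space M \<Longrightarrow> 0 \<le> \<gamma> t s a \<omega>"
    and step_async: "\<And>t s a \<omega>. \<omega> \<in> space M \<Longrightarrow> (s, a) \<noteq> (st t \<omega>, act t \<omega>) \<Longrightarrow> \<gamma> t s a \<omega> = 0"
    and sample_measurable: "\<And>t. X t \<in> F (Suc t) \<rightarrow>\<^sub>M count_space UNIV"
    and sample_law: "\<And>t. has_cond_law M (F t) (X t) (\<lambda>\<omega>. p (st t \<omega>) (act t \<omega>))"
    and step_sum: "\<And>s a. AE \<omega> in M. filterlim (\<lambda>n. \<Sum>t<n. \<gamma> t s a \<omega>) at_top sequentially"
    and step_square_sum: "\<And>s a. AE \<omega> in M. summable (\<lambda>t. (\<gamma> t s a \<omega>)\<^sup>2)"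
    and Q_init: "\<And>\<omega>. \<omega> \<in> space M \<Longrightarrow> Q 0 \<omega> = Q\<^sub>0"
    and Q_step: "\<And>t s a \<omega>. \<omega> \<in> space M \<Longrightarrow>
      Q (Suc t) \<omega> s a = (1 - \<gamma> t s a \<omega>) * Q t \<omega> s a
        + \<gamma> t s a \<omega> * (R s a (X t \<omega>) + \<beta> * (MAX b\<in>UNIV. Q t \<omega> (X t \<omega>) b))"
  shows "AE \<omega> in M. \<forall>s a. (\<lambda>t. Q t \<omega> s a) \<longlonglongrightarrow> Q_star p R \<beta> s a"
proof -
  interpret prob_space M by (rule prob)
  interpret filtration "space M" F by (rule filt)
  have \<beta>: "0 \<le> \<beta>" "\<beta> < 1" using discount by simp_all
  have Q_measurable: "(\<lambda>\<omega>. Q t \<omega> s a) \<in> borel_measurable (F t)" for t s a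
  proof (induction t arbitrary: s a)
    case 0
    have "(\<lambda>\<omega>. Q 0 \<omega> s a) \<in> borel_measurable (F 0) \<longleftrightarrow> (\<lambda>\<omega>. Q\<^sub>0 s a) \<in> borel_measurable (F 0)"
      by (intro measurable_cong) (simp add: Q_init space_F)
    then show ?case by simp
  next
    case (Suc t)
    note [measurable] = borel_measurable_mono[OF le_SucI[OF order_refl] Suc]
      borel_measurable_mono[OF le_SucI[OF order_refl] step_measurable] sample_measurable
    have "(\<lambda>\<omega>. Q (Suc t) \<omega> s a) \<in> borel_measurable (F (Suc t)) \<longleftrightarrow>
      (\<lambda>\<omega>. (1 - \<gamma> t s a \<omega>) * Q t \<omega> s a
        + \<gamma> t s a \<omega> * (R s a (X t \<omega>) + \<beta> * (MAX b\<in>UNIV. Q t \<omega> (X t \<omega>) b))) \<in> borel_measurable (F (Suc t))"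
      by (intro measurable_cong) (simp add: Q_step space_F)
    moreover have "(\<lambda>\<omega>. R s a (X t \<omega>) + \<beta> * (MAX b\<in>UNIV. Q t \<omega> (X t \<omega>) b)) \<in> borel_measurable (F (Suc t))"
      \<comment> \<open>The state argument of \<open>Q t\<close> is random; splitting over its
        countably many values reduces to fixed states.\<close>
      by (rule measurable_compose_countable[where g = "X t"
            and f = "\<lambda>x \<omega>. R s a x + \<beta> * (MAX b\<in>UNIV. Q t \<omega> x b)"]) measurable
    ultimately show ?case by simp
  qed

  have "AE \<omega> in M. \<forall>i. summable (\<lambda>t. (\<gamma> t (fst i) (snd i) \<omega>)\<^sup>2)"
    unfolding AE_all_countable using step_square_sum by simp
  \<comment> \<open>Square summable steps tend to 0. The time from which they stay below 1 depends
    on the path, and hence so does the bound on the iterates.\<close>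
  then have small_steps: "AE \<omega> in M. \<forall>i. \<forall>\<^sub>F t in sequentially.
      0 \<le> \<gamma> t (fst i) (snd i) \<omega> \<and> \<gamma> t (fst i) (snd i) \<omega> \<le> 1"
    using AE_space
  proof eventually_elim
    case (elim \<omega>)
    show ?case
    proof
      fix i
      have "(\<lambda>t. (\<gamma> t (fst i) (snd i) \<omega>)\<^sup>2) \<longlonglongrightarrow> 0"
        using elim by (intro summable_LIMSEQ_zero) simp
      then have "\<forall>\<^sub>F t in sequentially. (\<gamma> t (fst i) (snd i) \<omega>)\<^sup>2 < 1"
        by (rule order_tendstoD(2)) simp
      then show "\<forall>\<^sub>F t in sequentially. 0 \<le> \<gamma> t (fst i) (snd i) \<omega> \<and> \<gamma> t (fst i) (snd i) \<omega> \<le> 1"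
        by eventually_elim
          (use elim(2) step_nonneg in \<open>auto simp: abs_square_less_1 intro: less_imp_le\<close>)
    qed
  qed

  define c where "c = (\<Sum>i\<in>UNIV. \<bar>case i of (s, a, x) \<Rightarrow> R s a x\<bar>)"
  have R_le: "\<bar>R s a x\<bar> \<le> c" for s a x
    unfolding c_def using member_le_sum[of "(s, a, x)" UNIV "\<lambda>i. \<bar>case i of (s, a, x) \<Rightarrow> R s a x\<bar>"]
    by simp
  have target_le: "\<bar>R s a x + \<beta> * (MAX b\<in>UNIV. q x b)\<bar> \<le> c + \<beta> * D"
    if "\<And>s a. \<bar>q s a\<bar> \<le> D" for q :: "'s \<Rightarrow> 'a \<Rightarrow> real" and s a x D
  proof -
    have "\<bar>\<beta> * (MAX b\<in>UNIV. q x b)\<bar> \<le> \<beta> * D"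
      using abs_Max_le[of "q x" D] that \<beta> by (simp add: abs_mult mult_left_mono)
    then show ?thesis using R_le[of s a x] by linarith
  qed
  have Q_bounded: "AE \<omega> in M. \<exists>B. \<forall>t s a. \<bar>Q t \<omega> s a\<bar> \<le> B"
    using small_steps AE_space
  proof eventually_elim
    case (elim \<omega>)
    have "\<exists>B. \<forall>t i. \<bar>Q t \<omega> (fst i) (snd i)\<bar> \<le> B"
    proof (rule bounded_relaxation[OF \<beta>])
      show "\<forall>\<^sub>F t in sequentially. 0 \<le> \<gamma> t (fst i) (snd i) \<omega> \<and> \<gamma> t (fst i) (snd i) \<omega> \<le> 1" for i
        using elim(1) by blast
      show "Q (Suc t) \<omega> (fst i) (snd i) = (1 - \<gamma> t (fst i) (snd i) \<omega>) * Q t \<omega> (fst i) (snd i)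
        + \<gamma> t (fst i) (snd i) \<omega> * (R (fst i) (snd i) (X t \<omega>) + \<beta> * (MAX b\<in>UNIV. Q t \<omega> (X t \<omega>) b))" for t i
        using elim(2) by (rule Q_step)
      show "\<bar>R (fst i) (snd i) (X t \<omega>) + \<beta> * (MAX b\<in>UNIV. Q t \<omega> (X t \<omega>) b)\<bar> \<le> c + \<beta> * D"
        if "\<And>j. \<bar>Q t \<omega> (fst j) (snd j)\<bar> \<le> D" for t i D
        by (rule target_le) (use that in force)
    qed
    then show ?case by force
  qed

  \<comment> \<open>\<open>v\<close> is the update target as a function of a hypothetical next
    state; \<open>w\<close> is its value at the sample minus its mean under
    \<open>p s a\<close>.\<close>
  define v where "v s a t x \<omega> = R s a x + \<beta> * (MAX b\<in>UNIV. Q t \<omega> x b)" for s a t x \<omega>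
  define w where "w t i \<omega> = v (fst i) (snd i) t (X t \<omega>) \<omega> - bellman p R \<beta> (Q t \<omega>) (fst i) (snd i)" for t i \<omega>
  have noise: "AE \<omega> in M. convergent (\<lambda>n. \<Sum>t<n. \<gamma> t s a \<omega> * w t (s, a) \<omega>)" for s a
  proof -
    have "AE \<omega> in M. convergent (\<lambda>n. \<Sum>t<n. \<gamma> t s a \<omega> *
        (v s a t (X t \<omega>) \<omega> - (\<Sum>x\<in>UNIV. pmf (p (st t \<omega>) (act t \<omega>)) x * v s a t x \<omega>)))"
    proof (rule AE_convergent_noise_series[OF prob filt subalg sample_measurable sample_law])
      show "(\<lambda>\<omega>. pmf (p (st t \<omega>) (act t \<omega>)) x) \<in> borel_measurable (F t)" for t x
        using measurable_compose[OF pair_measurable, of "\<lambda>(s, a). pmf (p s a) x" borel t] by simp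
      show "v s a t x \<in> borel_measurable (F t)" for t x
      proof -
        note Q_measurable[measurable]
        show ?thesis unfolding v_def by measurable
      qed
      show "AE \<omega> in M. \<exists>B. \<forall>t x. \<bar>v s a t x \<omega>\<bar> \<le> B"
        using Q_bounded
      proof eventually_elim
        case (elim \<omega>)
        then obtain B where "\<And>t s a. \<bar>Q t \<omega> s a\<bar> \<le> B" by blast
        then have "\<bar>v s a t x \<omega>\<bar> \<le> c + \<beta> * B" for t x
          unfolding v_def by (rule target_le)
        then show ?case by blast
      qed
    qed (fact step_measurable step_square_sum)+
    with AE_space show ?thesis
    proof eventually_elim
      case (elim \<omega>)
      \<comment> \<open>The sample is centred with the law of the visited pair, whereas
        \<open>w\<close> uses that of \<open>(s, a)\<close>. They agree when \<open>(s, a)\<close>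
        is visited, and otherwise the weight is 0.\<close>
      have "\<gamma> t s a \<omega> * (v s a t (X t \<omega>) \<omega> - (\<Sum>x\<in>UNIV. pmf (p (st t \<omega>) (act t \<omega>)) x * v s a t x \<omega>))
        = \<gamma> t s a \<omega> * w t (s, a) \<omega>" for t
        using step_async[OF elim(1), of s a t]
        by (cases "(s, a) = (st t \<omega>, act t \<omega>)") (auto simp: w_def bellman_def v_def)
      with elim(2) show ?case by (simp only:)
    qed
  qed
  have "AE \<omega> in M. \<forall>i. convergent (\<lambda>n. \<Sum>t<n. \<gamma> t (fst i) (snd i) \<omega> * w t i \<omega>)"
    unfolding AE_all_countable using noise by simp
  moreover have "AE \<omega> in M. \<forall>i. filterlim (\<lambda>n. \<Sum>t<n. \<gamma> t (fst i) (snd i) \<omega>) at_top sequentially"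
    unfolding AE_all_countable using step_sum by simp
  ultimately show ?thesis
    using small_steps Q_bounded AE_space
  proof eventually_elim
    case (elim \<omega>)
    define Qs where "Qs = Q_star p R \<beta>"
    have Qs: "bellman p R \<beta> Qs = Qs" unfolding Qs_def by (rule bellman_Q_star[OF \<beta>])
    obtain B where B: "\<And>t s a. \<bar>Q t \<omega> s a\<bar> \<le> B" using elim(4) by blast
    define C where "C = (\<Sum>i\<in>UNIV. \<bar>Qs (fst i) (snd i)\<bar>)"
    have C: "\<bar>Qs s a\<bar> \<le> C" for s a
      unfolding C_def using member_le_sum[of "(s, a)" UNIV "\<lambda>i. \<bar>Qs (fst i) (snd i)\<bar>"] by simp
    \<comment> \<open>Subtracting the fixed point turns the Bellman term into a difference of two
      images, which the contraction bounds by \<open>\<beta>\<close> times the error.\<close>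
    have "(\<lambda>t. Q t \<omega> (fst i) (snd i) - Qs (fst i) (snd i)) \<longlonglongrightarrow> 0" for i
    proof (rule asynchronous_contraction_tendsto_zero[OF \<beta>,
          where g = "\<lambda>t i. \<gamma> t (fst i) (snd i) \<omega>" and w = "\<lambda>t i. w t i \<omega>" and B = "B + C"
            and f = "\<lambda>t i. bellman p R \<beta> (Q t \<omega>) (fst i) (snd i) - Qs (fst i) (snd i)"])
      show "\<forall>\<^sub>F t in sequentially. 0 \<le> \<gamma> t (fst i) (snd i) \<omega> \<and> \<gamma> t (fst i) (snd i) \<omega> \<le> 1" for i
        using elim(3) by blast
      show "filterlim (\<lambda>n. \<Sum>t<n. \<gamma> t (fst i) (snd i) \<omega>) at_top sequentially" for i
        using elim(2) by blast
      show "convergent (\<lambda>n. \<Sum>t<n. \<gamma> t (fst i) (snd i) \<omega> * w t i \<omega>)" for i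
        using elim(1) by blast
      show "\<bar>Q t \<omega> (fst i) (snd i) - Qs (fst i) (snd i)\<bar> \<le> B + C" for t i
        using B[of t "fst i" "snd i"] C[of "fst i" "snd i"] by linarith
      show "Q (Suc t) \<omega> (fst i) (snd i) - Qs (fst i) (snd i) =
        (1 - \<gamma> t (fst i) (snd i) \<omega>) * (Q t \<omega> (fst i) (snd i) - Qs (fst i) (snd i)) +
        \<gamma> t (fst i) (snd i) \<omega> * (bellman p R \<beta> (Q t \<omega>) (fst i) (snd i) - Qs (fst i) (snd i) + w t i \<omega>)" for t i
        unfolding Q_step[OF elim(5)] w_def v_def by (simp add: algebra_simps)
      show "\<bar>bellman p R \<beta> (Q t \<omega>) (fst i) (snd i) - Qs (fst i) (snd i)\<bar> \<le> \<beta> * D"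
        if "\<And>j. \<bar>Q t \<omega> (fst j) (snd j) - Qs (fst j) (snd j)\<bar> \<le> D" for t i D
        using bellman_contraction[of \<beta> "Q t \<omega>" Qs D p R "fst i" "snd i"] \<beta> that[of "(_, _)"]
        by (simp add: Qs)
    qed
    then have "(\<lambda>t. Q t \<omega> s a) \<longlonglongrightarrow> Qs s a" for s a
      using LIM_zero_cancel[of "\<lambda>t. Q t \<omega> s a" "Qs s a"] by force
    then show ?case by (simp add: Qs_def)
  qed
qed

end
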